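(* There is a constant $C \geq 0$ for which the following holds for all integers $n \ge 1$ and $k \ge 0$. If $\alpha, \beta \in S_n$ satisfy $d_U(\alpha,\beta) = k$, then \[ \Big|\{\gamma \in S_n : d_U(\alpha,\gamma) \leq k \text{ and } d_U(\beta,\gamma) \leq k\}\Big| \leq 2^{k + C k^{2/3}} \frac{n!}{(n-k)!}. \]
   Context: Let $S_n$ denote the set of permutations of $\{1,\ldots,n\}$, written in one-line notation as strings $\sigma(1)\sigma(2)\cdots\sigma(n)$. For $\sigma \in S_n$ and $A \subseteq \{1,\ldots,n\}$, $\sigma - A$ denotes the string obtained from $\sigma$ by deleting all symbols in $A$ (and contracting). The Ulam distance is $d_U(\alpha,\beta) = \min\{|A| : \alpha - A = \beta - A\}$ for $\alpha,\beta \in S_n$. *)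

theory Defs
  imports Complex_Main "HOL-Combinatorics.Permutations"
begin

definition sym_perms :: "nat \<Rightarrow> (nat \<Rightarrow> nat) set" where
  "sym_perms n = {\<sigma>. \<sigma> permutes {1..n}}"

definition one_line :: "nat \<Rightarrow> (nat \<Rightarrow> nat) \<Rightarrow> nat list" where
  "one_line n \<sigma> = map \<sigma> [1..<Suc n]"

definition delete_symbols :: "nat \<Rightarrow> (nat \<Rightarrow> nat) \<Rightarrow> nat set \<Rightarrow> nat list" where
  "delete_symbols n \<sigma> A = filter (\<lambda>x. x \<notin> A) (one_line n \<sigma>)"

definition ulam_dist :: "nat \<Rightarrow> (nat \<Rightarrow> nat) \<Rightarrow> (nat \<Rightarrow> nat) \<Rightarrow> nat" where
  "ulam_dist n \<alpha> \<beta> =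
     Min {card A | A. A \<subseteq> {1..n} \<and> delete_symbols n \<alpha> A = delete_symbols n \<beta> A}"

text \<open>On permutations the minimum is over a finite nonempty set: deleting all symbols
  always gives equal strings. In particular the distance never exceeds n.\<close>

lemma ulam_dist_le:
  assumes "\<alpha> \<in> sym_perms n" "\<beta> \<in> sym_perms n"
  shows "ulam_dist n \<alpha> \<beta> \<le> n"
proof -
  let ?S = "{card A | A. A \<subseteq> {1..n} \<and> delete_symbols n \<alpha> A = delete_symbols n \<beta> A}"
  have "?S \<subseteq> card ` Pow {1..n}" by auto
  then have fin: "finite ?S" by (rule finite_subset) simp
  have empty: "delete_symbols n \<sigma> {1..n} = []" if "\<sigma> \<in> sym_perms n" for \<sigma>
  proof -
    have "set [1..<Suc n] = {1..n}" by auto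
    moreover have "\<sigma> ` {1..n} = {1..n}"
      using that by (simp add: sym_perms_def permutes_image)
    ultimately have "set (one_line n \<sigma>) = {1..n}"
      by (simp only: one_line_def set_map)
    then show ?thesis
      by (simp only: delete_symbols_def filter_empty_conv) simp
  qed
  have "card {1..n} \<in> ?S"
    using empty[OF assms(1)] empty[OF assms(2)] by (intro CollectI exI[of _ "{1..n}"]) simp
  then show ?thesis
    unfolding ulam_dist_def using Min_le[OF fin] by simp
qed

end

theory Submission
  imports Defs "HOL-Library.FuncSet"
begin

text \<open>If \<open>\<gamma>\<close> is within \<open>k\<close> of both \<open>\<alpha>\<close> and \<open>\<beta>\<close>, choose \<open>k\<close>-sets \<open>A\<close>, \<open>B\<close> of symbols with
  \<open>\<gamma> - A = \<alpha> - A\<close> and \<open>\<gamma> - B = \<beta> - B\<close>, and put \<open>E = A \<union> B\<close>, \<open>card E = k + j\<close>. The complement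
  of \<open>E\<close> is a common subsequence of \<open>\<alpha>\<close> and \<open>\<beta>\<close> of length \<open>L - j\<close>, where \<open>L = n - k\<close> is the largest
  possible one. Common subsequences are chains of a partial order of height \<open>L\<close> on \<open>n\<close> symbols;
  a chain meets each of the \<open>L\<close> levels at most once, and the product of the level sizes is at most
  \<open>2 ^ (n - L)\<close>, so there are at most \<open>2 ^ k * (L choose j)\<close> sets \<open>E\<close>. Given \<open>A\<close> and \<open>B\<close>, the string
  \<open>\<gamma> - (A \<inter> B)\<close> is known up to shuffling \<open>A - B\<close> with \<open>B - A\<close>, and the \<open>k - j\<close> remaining symbols
  are inserted in \<open>n! / (n - k + j)!\<close> ways. Altogether the count is at most
  \<open>2 ^ k * n! / (n - k)! * (\<Sum>j. 16 ^ j * k ^ (2 * j) / (j!) ^ 3)\<close>, and the sum is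
  \<open>exp (O(k powr (2/3)))\<close> because \<open>\<Sum>j. x ^ (3 * j) / (j!) ^ 3 \<le> (\<Sum>j. x ^ j / j!) ^ 3\<close>.\<close>

subsection \<open>Chains of almost maximal size\<close>

text \<open>Grading elements by the longest chain ending at them splits \<open>V\<close> into
  \<open>L\<close> levels. A chain has at most one element per level, so it is fixed by the
  \<open>m\<close> levels it meets, chosen in \<open>L choose m\<close> ways, and by one element in
  each of them.\<close>

lemma card_chains_le:
  fixes V :: "'a set" and R :: "'a \<Rightarrow> 'a \<Rightarrow> bool"
  assumes V: "finite V" and tr: "transp R" and ir: "irreflp R"
    and height: "\<And>X. X \<subseteq> V \<Longrightarrow> totalp_on X R \<Longrightarrow> card X \<le> L"
    and X0: "X0 \<subseteq> V" "totalp_on X0 R" "card X0 = L"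
  shows "card {X. X \<subseteq> V \<and> totalp_on X R \<and> card X = m} \<le> 2 ^ (card V - L) * (L choose m)"
proof -
  \<comment> \<open>Chains with top element \<open>x\<close>; \<open>r x\<close> is the largest size
    of such a chain.\<close>
  define below where "below x = {X. X \<subseteq> V \<and> totalp_on X R \<and> x \<in> X \<and> (\<forall>y\<in>X - {x}. R y x)}" for x
  define r where "r x = Max (card ` below x)" for x
  define lev where "lev i = {x\<in>V. r x = i}" for i
  have fin_below: "finite (card ` below x)" for x
  proof -
    have "below x \<subseteq> Pow V" by (auto simp: below_def)
    then show ?thesis using V by (meson finite_Pow_iff finite_imageI finite_subset)
  qed
  have single: "{x} \<in> below x" if "x \<in> V" for x
    using that by (auto simp: below_def totalp_on_def)
  have r_attained: "\<exists>X\<in>below x. card X = r x" if "x \<in> V" for x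
  proof -
    have "r x \<in> card ` below x"
      unfolding r_def using fin_below single[OF that] by (intro Max_in) auto
    then show ?thesis by auto
  qed
  have r_range: "r x \<in> {1..L}" if x: "x \<in> V" for x
  proof -
    have "card {x} \<le> r x"
      unfolding r_def using fin_below single[OF x] by (intro Max_ge imageI) auto
    moreover obtain X where "X \<in> below x" "card X = r x" using r_attained[OF x] by blast
    ultimately show ?thesis using height[of X] by (auto simp: below_def)
  qed
  \<comment> \<open>A longest chain with top \<open>x\<close> extends by \<open>y\<close>. Hence
    distinct elements of a chain have distinct ranks.\<close>
  have r_mono: "r x < r y" if xy: "x \<in> V" "y \<in> V" "R x y" for x y
  proof -
    obtain X where X: "X \<in> below x" "card X = r x" using r_attained[OF xy(1)] by blast
    have under: "R z y" if "z \<in> X" for z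
      using that X(1) xy(3) tr by (auto simp: below_def dest: transpD)
    then have "y \<notin> X" using ir by (auto dest: irreflpD)
    moreover have "finite X" using X(1) V by (auto simp: below_def intro: finite_subset)
    ultimately have "card (insert y X) = Suc (r x)" using X(2) by simp
    moreover have "insert y X \<in> below y"
      using X(1) xy(2) under by (auto simp: below_def totalp_on_def)
    then have "card (insert y X) \<le> r y"
      unfolding r_def using fin_below by (intro Max_ge imageI) auto
    ultimately show ?thesis by simp
  qed
  have r_inj: "inj_on r X" if "X \<subseteq> V" "totalp_on X R" for X
  proof (rule inj_onI, rule ccontr)
    fix x y assume xy: "x \<in> X" "y \<in> X" "r x = r y" "x \<noteq> y"
    then have "R x y \<or> R y x" using that(2) by (auto simp: totalp_on_def)
    then show False using r_mono[of x y] r_mono[of y x] xy that(1) by auto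
  qed
  have fin_lev: "finite (lev i)" for i using V by (simp add: lev_def)
  \<comment> \<open>The \<open>L\<close> elements of \<open>X0\<close> have distinct ranks in
    \<open>{1..L}\<close>, so they fill every level. Nonempty levels keep the subtractions
    \<open>card (lev i) - 1\<close> below from being truncated.\<close>
  have lev_pos: "1 \<le> card (lev i)" if i: "i \<in> {1..L}" for i
  proof -
    have "r ` X0 = {1..L}"
      using card_image[OF r_inj[OF X0(1,2)]] X0 r_range by (intro card_subset_eq) auto
    then obtain x where "x \<in> X0" "r x = i" using i by (metis imageE)
    then have "lev i \<noteq> {}" using X0(1) by (auto simp: lev_def)
    then show ?thesis using fin_lev by (simp add: Suc_leI card_gt_0_iff)
  qed
  have "V = (\<Union>i\<in>{1..L}. lev i)" using r_range by (auto simp: lev_def)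
  then have "card V = card (\<Union>i\<in>{1..L}. lev i)" by simp
  also have "\<dots> = (\<Sum>i\<in>{1..L}. card (lev i))"
    using fin_lev by (intro card_UN_disjoint) (auto simp: lev_def)
  finally have card_V: "card V = (\<Sum>i\<in>{1..L}. card (lev i))" .
  \<comment> \<open>Each size \<open>s \<ge> 1\<close> satisfies \<open>s \<le> 2 ^ (s - 1)\<close>,
    and over all \<open>L\<close> levels the exponents \<open>s - 1\<close> add up to
    \<open>card V - L\<close>.\<close>
  have prod_le: "(\<Prod>i\<in>T. card (lev i)) \<le> 2 ^ (card V - L)" if T: "T \<subseteq> {1..L}" for T
  proof -
    have "(\<Prod>i\<in>T. card (lev i)) \<le> (\<Prod>i\<in>T. 2 ^ (card (lev i) - 1))"
    proof (intro prod_mono conjI)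
      fix i assume "i \<in> T"
      then have "1 \<le> card (lev i)" using lev_pos T by blast
      then show "card (lev i) \<le> 2 ^ (card (lev i) - 1)"
        using less_exp[of "card (lev i) - 1"] by linarith
    qed simp
    also have "\<dots> = 2 ^ (\<Sum>i\<in>T. card (lev i) - 1)" by (simp add: power_sum)
    also have "\<dots> \<le> 2 ^ (\<Sum>i\<in>{1..L}. card (lev i) - 1)"
      using T by (intro power_increasing sum_mono2) auto
    also have "(\<Sum>i\<in>{1..L}. card (lev i) - 1) = card V - L"
      unfolding card_V using lev_pos by (subst sum_subtractf_nat) auto
    finally show ?thesis .
  qed
  define Ts where "Ts = {T. T \<subseteq> {1..L} \<and> card T = m}"
  have Ts: "finite Ts" "card Ts = L choose m"
    using n_subsets[of "{1..L}" m] by (auto simp: Ts_def)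
  \<comment> \<open>A chain is recovered from its set \<open>T\<close> of ranks and the function
    sending each rank in \<open>T\<close> to the element of the chain on that level.\<close>
  have "{X. X \<subseteq> V \<and> totalp_on X R \<and> card X = m} \<subseteq> (\<Union>T\<in>Ts. (\<lambda>f. f ` T) ` PiE T lev)"
  proof
    fix X assume "X \<in> {X. X \<subseteq> V \<and> totalp_on X R \<and> card X = m}"
    then have X: "X \<subseteq> V" "totalp_on X R" "card X = m" by auto
    define f where "f = restrict (the_inv_into X r) (r ` X)"
    have inj: "inj_on r X" using r_inj X by blast
    have "r ` X \<in> Ts" using card_image[OF inj] X r_range by (auto simp: Ts_def)
    moreover have "f \<in> PiE (r ` X) lev"
      using inj X(1) by (auto simp: f_def lev_def the_inv_into_f_f)
    moreover have "X = f ` (r ` X)"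
      using inj by (auto simp: f_def the_inv_into_f_f image_image)
    ultimately show "X \<in> (\<Union>T\<in>Ts. (\<lambda>f. f ` T) ` PiE T lev)" by blast
  qed
  moreover have fin_PiE: "finite (PiE T lev)" if "T \<in> Ts" for T
    using that fin_lev by (intro finite_PiE) (auto simp: Ts_def intro: finite_subset)
  ultimately have "card {X. X \<subseteq> V \<and> totalp_on X R \<and> card X = m}
      \<le> card (\<Union>T\<in>Ts. (\<lambda>f. f ` T) ` PiE T lev)"
    using Ts by (intro card_mono finite_UN_I) auto
  also have "\<dots> \<le> (\<Sum>T\<in>Ts. card ((\<lambda>f. f ` T) ` PiE T lev))"
    using Ts by (intro card_UN_le) auto
  also have "\<dots> \<le> (\<Sum>T\<in>Ts. 2 ^ (card V - L))"
  proof (rule sum_mono)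
    fix T assume T: "T \<in> Ts"
    have "card ((\<lambda>f. f ` T) ` PiE T lev) \<le> card (PiE T lev)"
      by (rule card_image_le[OF fin_PiE[OF T]])
    also have "\<dots> = (\<Prod>i\<in>T. card (lev i))"
      using T by (intro card_PiE) (auto simp: Ts_def intro: finite_subset)
    also have "\<dots> \<le> 2 ^ (card V - L)" using T by (intro prod_le) (auto simp: Ts_def)
    finally show "card ((\<lambda>f. f ` T) ` PiE T lev) \<le> 2 ^ (card V - L)" .
  qed
  finally show ?thesis using Ts by (simp add: mult.commute)
qed

subsection \<open>Reinserting and shuffling symbols\<close>

text \<open>Putting the symbols of \<open>I\<close> back one at a time: a string of length
  \<open>d\<close> offers \<open>d + 1\<close> slots to the next symbol, and these factors multiply
  to the quotient of the two factorials. The product form avoids division in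
  \<open>nat\<close>.\<close>

lemma card_reinsertions_le:
  fixes S :: "'a set"
  assumes "finite S" "finite I" "I \<subseteq> S"
  shows "card {xs. distinct xs \<and> set xs = S \<and> filter (\<lambda>y. y \<notin> I) xs = w} * fact (card S - card I)
    \<le> fact (card S)"
  using assms(2,3)
proof (induction I arbitrary: w rule: finite_induct)
  case empty
  have "{xs. distinct xs \<and> set xs = S \<and> filter (\<lambda>y. y \<notin> {}) xs = w} \<subseteq> {w}" by auto
  then have "card {xs. distinct xs \<and> set xs = S \<and> filter (\<lambda>y. y \<notin> {}) xs = w} \<le> 1"
    using card_mono[of "{w}"] by fastforce
  then show ?case by simp
next
  case (insert x I)
  define ext where "ext J w = {xs. distinct xs \<and> set xs = S \<and> filter (\<lambda>y. y \<notin> J) xs = w}" for J w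
  define d where "d = card S - card (insert x I)"
  have "card (insert x I) \<le> card S" using insert.prems assms(1) by (intro card_mono)
  then have d: "card S - card I = Suc d" using insert.hyps by (simp add: d_def)
  have fin: "finite (ext J w)" for J w
    by (rule finite_subset[OF _ finite_subset_distinct[OF assms(1)]]) (auto simp: ext_def)
  \<comment> \<open>Deleting only \<open>I\<close> from \<open>xs\<close> leaves \<open>w\<close>
    with \<open>x\<close> inserted at some slot \<open>i\<close>.\<close>
  have "ext (insert x I) w \<subseteq> (\<Union>i\<in>{..d}. ext I (take i w @ x # drop i w))"
  proof
    fix xs assume "xs \<in> ext (insert x I) w"
    then have xs: "distinct xs" "set xs = S" "filter (\<lambda>y. y \<notin> insert x I) xs = w"
      by (auto simp: ext_def)
    define w' where "w' = filter (\<lambda>y. y \<notin> I) xs"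
    have "x \<in> set w'" using insert.prems insert.hyps xs(2) by (auto simp: w'_def)
    then obtain u v where uv: "w' = u @ x # v" by (meson split_list)
    have "distinct w'" using xs(1) by (simp add: w'_def)
    have "w = filter (\<lambda>y. y \<noteq> x) w'" using xs(3) by (auto simp: w'_def intro: filter_cong)
    also have "\<dots> = u @ v"
      using \<open>distinct w'\<close> uv by (auto intro!: arg_cong2[where f = "(@)"] filter_True)
    finally have w: "w = u @ v" .
    have "length w = card (set w)" 
      using xs(1,3) by (metis distinct_card distinct_filter)
    also have "set w = S - insert x I" using xs by auto
    also have "card \<dots> = d" 
      using insert by (simp add: d_def card_Diff_subset)
    finally have "length u \<in> {..d}" using w by simp
    moreover have "xs \<in> ext I (take (length u) w @ x # drop (length u) w)"
      using xs uv w by (auto simp: ext_def w'_def)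
    ultimately show "xs \<in> (\<Union>i\<in>{..d}. ext I (take i w @ x # drop i w))" by blast
  qed
  then have "card (ext (insert x I) w) \<le> card (\<Union>i\<in>{..d}. ext I (take i w @ x # drop i w))"
    using fin by (intro card_mono) auto
  also have "\<dots> \<le> (\<Sum>i\<in>{..d}. card (ext I (take i w @ x # drop i w)))"
    by (intro card_UN_le) auto
  finally have "card (ext (insert x I) w) * fact (Suc d)
      \<le> (\<Sum>i\<in>{..d}. card (ext I (take i w @ x # drop i w)) * fact (card S - card I))"
    by (simp only: d mult_le_mono1 flip: sum_distrib_right)
  also have "\<dots> \<le> (\<Sum>i\<in>{..d}. fact (card S))"
    using insert.IH insert.prems unfolding ext_def by (intro sum_mono) auto
  finally have "Suc d * (card (ext (insert x I) w) * fact d) \<le> Suc d * fact (card S)"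
    by (simp add: algebra_simps)
  then show ?case unfolding ext_def d_def by (simp only: mult_le_cancel1)
qed

text \<open>Compare the first symbols of the two strings. If both survive the deletion of
  \<open>P\<close>, or both survive that of \<open>Q\<close>, they agree. Otherwise one lies in
  \<open>P\<close> and the other in \<open>Q\<close>, and then the Boolean words already differ at
  their first letter.\<close>

lemma shuffle_unique:
  assumes "P \<inter> Q = {}"
    and "filter (\<lambda>y. y \<notin> P) xs = filter (\<lambda>y. y \<notin> P) ys"
    and "filter (\<lambda>y. y \<notin> Q) xs = filter (\<lambda>y. y \<notin> Q) ys"
    and "map (\<lambda>y. y \<in> P) (filter (\<lambda>y. y \<in> P \<union> Q) xs) = map (\<lambda>y. y \<in> P) (filter (\<lambda>y. y \<in> P \<union> Q) ys)"
  shows "xs = ys"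
  using assms(2-)
proof (induction xs arbitrary: ys)
  case Nil
  have "y \<in> P \<and> y \<in> Q" if "y \<in> set ys" for y
    using Nil that by (metis filter.simps(1) filter_empty_conv)
  then show ?case using assms(1) by (cases ys) auto
next
  case (Cons x xs)
  show ?case
  proof (cases ys)
    case Nil
    then have "x \<in> P \<and> x \<in> Q" using Cons.prems by (auto split: if_splits)
    then show ?thesis using assms(1) by auto
  next
    case (Cons y zs)
    then have "x = y" using Cons.prems assms(1) by (auto split: if_splits)
    then show ?thesis using Cons.prems Cons.IH[of zs] Cons by (auto split: if_splits)
  qed
qed

text \<open>Made for \<open>E = A \<union> B\<close>, \<open>P = A - B\<close>,
  \<open>Q = B - A\<close>: then \<open>E - Q = A\<close>, \<open>E - P = B\<close>, and
  \<open>E - P - Q = A \<inter> B\<close>. The power of 2 counts the shuffles of \<open>P\<close>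
  with \<open>Q\<close>, and the factorials count the reinsertions of
  \<open>A \<inter> B\<close>.\<close>

lemma card_two_restrictions_le:
  fixes S :: "'a set"
  assumes S: "finite S" "E \<subseteq> S" and PQ: "P \<subseteq> E" "Q \<subseteq> E" "P \<inter> Q = {}"
  shows "card {xs. distinct xs \<and> set xs = S \<and> filter (\<lambda>y. y \<notin> E - Q) xs = u \<and>
      filter (\<lambda>y. y \<notin> E - P) xs = v} * fact (card S - card (E - P - Q))
    \<le> 2 ^ (card P + card Q) * fact (card S)"
    (is "card ?G * _ \<le> _")
proof -
  define I where "I = E - P - Q"
  define ext where "ext w = {xs. distinct xs \<and> set xs = S \<and> filter (\<lambda>y. y \<notin> I) xs = w}" for w
  \<comment> \<open>Candidates for what remains of \<open>xs\<close> after deleting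
    \<open>I\<close>. By \<open>shuffle_unique\<close>, the Boolean word \<open>f w\<close>
    determines such a \<open>w\<close>.\<close>
  define W where "W = {w. filter (\<lambda>y. y \<notin> P) w = u \<and> filter (\<lambda>y. y \<notin> Q) w = v \<and>
    length (filter (\<lambda>y. y \<in> P \<union> Q) w) = card P + card Q}"
  define f where "f w = map (\<lambda>y. y \<in> P) (filter (\<lambda>y. y \<in> P \<union> Q) w)" for w
  define B where "B = {bs::bool list. set bs \<subseteq> UNIV \<and> length bs = card P + card Q}"
  have B: "finite B" "card B = 2 ^ (card P + card Q)"
    using card_lists_length_eq[of "UNIV::bool set"] finite_lists_length_eq[of "UNIV::bool set"]
    by (auto simp: B_def)
  have "inj_on f W"
  proof (rule inj_onI)
    fix x y assume "x \<in> W" "y \<in> W" "f x = f y"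
    then show "x = y" by (intro shuffle_unique[OF PQ(3), of x y]) (simp_all add: W_def f_def)
  qed
  moreover have "f ` W \<subseteq> B" by (auto simp: W_def f_def B_def)
  ultimately have W: "finite W" "card W \<le> 2 ^ (card P + card Q)"
    using B inj_on_finite[of f W B] card_inj_on_le[of f W B] by auto
  have fin: "finite (ext w)" for w
    by (rule finite_subset[OF _ finite_subset_distinct[OF S(1)]]) (auto simp: ext_def)
  have "?G \<subseteq> (\<Union>w\<in>W. ext w)"
  proof
    fix xs assume "xs \<in> ?G"
    then have xs: "distinct xs" "set xs = S" "filter (\<lambda>y. y \<notin> E - Q) xs = u"
      "filter (\<lambda>y. y \<notin> E - P) xs = v" by auto
    define w where "w = filter (\<lambda>y. y \<notin> I) xs"
    have "filter (\<lambda>y. y \<notin> P) w = u"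
      using xs(3) PQ by (auto simp: w_def I_def intro!: filter_cong)
    moreover have "filter (\<lambda>y. y \<notin> Q) w = v"
      using xs(4) PQ by (auto simp: w_def I_def intro!: filter_cong)
    moreover have "length (filter (\<lambda>y. y \<in> P \<union> Q) w) = card P + card Q"
    proof -
      have "length (filter (\<lambda>y. y \<in> P \<union> Q) w) = card (set (filter (\<lambda>y. y \<in> P \<union> Q) w))"
        using xs(1) by (intro distinct_card[symmetric]) (simp add: w_def)
      also have "set (filter (\<lambda>y. y \<in> P \<union> Q) w) = P \<union> Q"
        using xs(2) PQ S by (auto simp: w_def I_def)
      also have "card \<dots> = card P + card Q"
        using PQ S by (intro card_Un_disjoint) (meson finite_subset)+
      finally show ?thesis .
    qed
    ultimately have "w \<in> W" by (simp add: W_def)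
    moreover have "xs \<in> ext w" using xs by (simp add: ext_def w_def)
    ultimately show "xs \<in> (\<Union>w\<in>W. ext w)" by blast
  qed
  then have "card ?G \<le> card (\<Union>w\<in>W. ext w)" using W fin by (intro card_mono) auto
  also have "\<dots> \<le> (\<Sum>w\<in>W. card (ext w))" using W by (intro card_UN_le)
  finally have "card ?G * fact (card S - card I) \<le> (\<Sum>w\<in>W. card (ext w) * fact (card S - card I))"
    by (simp flip: sum_distrib_right)
  also have "\<dots> \<le> (\<Sum>w\<in>W. fact (card S))"
    unfolding ext_def using S
    by (intro sum_mono card_reinsertions_le) (auto simp: I_def intro: finite_subset)
  also have "\<dots> \<le> 2 ^ (card P + card Q) * fact (card S)" using W by simp
  finally show ?thesis by (simp only: I_def)
qed

subsection \<open>Common subsequences of two permutations\<close>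

lemma set_one_line: "\<sigma> \<in> sym_perms n \<Longrightarrow> set (one_line n \<sigma>) = {1..n}"
proof -
  assume "\<sigma> \<in> sym_perms n"
  moreover have "set [1..<Suc n] = {1..n}" by auto
  ultimately show ?thesis
    by (simp only: one_line_def set_map sym_perms_def mem_Collect_eq permutes_image)
qed

lemma distinct_one_line: "\<sigma> \<in> sym_perms n \<Longrightarrow> distinct (one_line n \<sigma>)"
  by (auto simp: one_line_def sym_perms_def distinct_map permutes_inj_on)

lemma inj_on_one_line: "inj_on (one_line n) (sym_perms n)"
proof (rule inj_onI)
  fix \<sigma> \<tau> assume a: "\<sigma> \<in> sym_perms n" "\<tau> \<in> sym_perms n" "one_line n \<sigma> = one_line n \<tau>"
  show "\<sigma> = \<tau>"
  proof
    fix x show "\<sigma> x = \<tau> x"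
    proof (cases "x \<in> {1..n}")
      case True
      then show ?thesis using a(3) by (auto simp: one_line_def)
    next
      case False
      then show ?thesis using a(1,2) by (simp add: sym_perms_def permutes_not_in)
    qed
  qed
qed

lemma set_delete_symbols: "\<sigma> \<in> sym_perms n \<Longrightarrow> set (delete_symbols n \<sigma> E) = {1..n} - E"
  by (auto simp: delete_symbols_def set_one_line)

lemma delete_symbols_mono:
  assumes "delete_symbols n \<sigma> A = delete_symbols n \<tau> A" "A \<subseteq> B"
  shows "delete_symbols n \<sigma> B = delete_symbols n \<tau> B"
proof -
  have "delete_symbols n \<rho> B = filter (\<lambda>x. x \<notin> B) (delete_symbols n \<rho> A)" for \<rho>
    using assms(2) by (auto simp: delete_symbols_def intro!: filter_cong)
  then show ?thesis using assms(1) by metis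
qed

lemma sorted_delete_symbols:
  assumes "\<sigma> \<in> sym_perms n"
  shows "sorted_wrt (\<lambda>x y. inv \<sigma> x < inv \<sigma> y) (delete_symbols n \<sigma> E)"
proof -
  have "inv \<sigma> (\<sigma> x) = x" for x
    using assms by (simp add: sym_perms_def permutes_inverses)
  then have "sorted_wrt (\<lambda>x y. inv \<sigma> x < inv \<sigma> y) (one_line n \<sigma>)"
    by (simp add: one_line_def sorted_wrt_map del: upt_Suc)
  then show ?thesis unfolding delete_symbols_def by (rule sorted_wrt_filter)
qed

text \<open>Since \<open>inv \<alpha> x\<close> is the position of the symbol \<open>x\<close> in
  the string of \<open>\<alpha>\<close>, this is the intersection of two linear orders on
  symbols.\<close>

definition precedes_in_both :: "(nat \<Rightarrow> nat) \<Rightarrow> (nat \<Rightarrow> nat) \<Rightarrow> nat \<Rightarrow> nat \<Rightarrow> bool" where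
  "precedes_in_both \<alpha> \<beta> x y \<longleftrightarrow> inv \<alpha> x < inv \<alpha> y \<and> inv \<beta> x < inv \<beta> y"

text \<open>This identifies common subsequences with chains. Forwards, one string is sorted by both
  positions. Backwards, on a chain the two position orders coincide, so both strings list the same
  set in increasing order of \<open>inv \<beta>\<close>, which can be done in one way only.\<close>

lemma delete_symbols_eq_iff:
  assumes \<alpha>: "\<alpha> \<in> sym_perms n" and \<beta>: "\<beta> \<in> sym_perms n"
  shows "delete_symbols n \<alpha> E = delete_symbols n \<beta> E
    \<longleftrightarrow> totalp_on ({1..n} - E) (precedes_in_both \<alpha> \<beta>)"
proof
  assume eq: "delete_symbols n \<alpha> E = delete_symbols n \<beta> E"
  let ?l = "delete_symbols n \<alpha> E"
  have "sorted_wrt (\<lambda>x y. inv \<alpha> x < inv \<alpha> y) ?l" "sorted_wrt (\<lambda>x y. inv \<beta> x < inv \<beta> y) ?l"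
    using sorted_delete_symbols[OF \<alpha>, of E] sorted_delete_symbols[OF \<beta>, of E] eq by auto
  then have "precedes_in_both \<alpha> \<beta> (?l ! i) (?l ! j)" if "i < j" "j < length ?l" for i j
    using that by (auto simp: precedes_in_both_def sorted_wrt_iff_nth_less)
  then have "totalp_on (set ?l) (precedes_in_both \<alpha> \<beta>)"
    unfolding totalp_on_def by (metis in_set_conv_nth linorder_neqE_nat)
  then show "totalp_on ({1..n} - E) (precedes_in_both \<alpha> \<beta>)"
    by (simp only: set_delete_symbols[OF \<alpha>])
next
  assume tot: "totalp_on ({1..n} - E) (precedes_in_both \<alpha> \<beta>)"
  have "sorted_wrt (\<lambda>x y. inv \<beta> x < inv \<beta> y) (delete_symbols n \<alpha> E)"
  proof (rule sorted_wrt_mono_rel[OF _ sorted_delete_symbols[OF \<alpha>]])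
    fix x y assume "x \<in> set (delete_symbols n \<alpha> E)" "y \<in> set (delete_symbols n \<alpha> E)"
      and less: "inv \<alpha> x < inv \<alpha> y"
    then have "x \<in> {1..n} - E" "y \<in> {1..n} - E" "x \<noteq> y"
      by (simp_all only: set_delete_symbols[OF \<alpha>]) auto
    then have "precedes_in_both \<alpha> \<beta> x y \<or> precedes_in_both \<alpha> \<beta> y x"
      using tot by (blast dest: totalp_onD)
    then show "inv \<beta> x < inv \<beta> y" using less by (auto simp: precedes_in_both_def)
  qed
  then have "sorted_wrt (<) (map (inv \<beta>) (delete_symbols n \<alpha> E))" by (simp add: sorted_wrt_map)
  moreover have "sorted_wrt (<) (map (inv \<beta>) (delete_symbols n \<beta> E))"
    using sorted_delete_symbols[OF \<beta>] by (simp add: sorted_wrt_map)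
  ultimately have "map (inv \<beta>) (delete_symbols n \<beta> E) = map (inv \<beta>) (delete_symbols n \<alpha> E)"
    by (rule strict_sorted_equal) (simp add: set_delete_symbols \<alpha> \<beta>)
  moreover have "inj (inv \<beta>)"
    using \<beta> by (auto simp: sym_perms_def intro: permutes_inj permutes_inv)
  ultimately show "delete_symbols n \<alpha> E = delete_symbols n \<beta> E"
    by (metis inj_map_eq_map)
qed

lemma ulam_dist_attained:
  assumes "\<alpha> \<in> sym_perms n" "\<beta> \<in> sym_perms n"
  obtains A where "A \<subseteq> {1..n}" "card A = ulam_dist n \<alpha> \<beta>"
    "delete_symbols n \<alpha> A = delete_symbols n \<beta> A"
proof -
  let ?S = "{card A | A. A \<subseteq> {1..n} \<and> delete_symbols n \<alpha> A = delete_symbols n \<beta> A}"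
  have "?S \<subseteq> card ` Pow {1..n}" by auto
  then have "finite ?S" by (rule finite_subset) simp
  moreover have "delete_symbols n \<sigma> {1..n} = []" if "\<sigma> \<in> sym_perms n" for \<sigma>
    using set_delete_symbols[OF that, of "{1..n}"] by simp
  then have "card {1..n} \<in> ?S"
    using assms by (intro CollectI exI[of _ "{1..n}"]) simp
  ultimately have "ulam_dist n \<alpha> \<beta> \<in> ?S" unfolding ulam_dist_def by (intro Min_in) auto
  then obtain A where "ulam_dist n \<alpha> \<beta> = card A" "A \<subseteq> {1..n}"
    "delete_symbols n \<alpha> A = delete_symbols n \<beta> A" unfolding mem_Collect_eq by blast
  then show ?thesis using that[of A] by simp
qed

lemma ulam_dist_le_card:
  assumes "A \<subseteq> {1..n}" "delete_symbols n \<alpha> A = delete_symbols n \<beta> A"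
  shows "ulam_dist n \<alpha> \<beta> \<le> card A"
proof -
  let ?S = "{card A | A. A \<subseteq> {1..n} \<and> delete_symbols n \<alpha> A = delete_symbols n \<beta> A}"
  have "?S \<subseteq> card ` Pow {1..n}" by auto
  then have "finite ?S" by (rule finite_subset) simp
  then show ?thesis unfolding ulam_dist_def using assms by (intro Min_le) auto
qed

text \<open>Deleting further symbols preserves equality, so a smallest deletion set may be padded to
  size exactly \<open>k\<close>. Equal sizes for \<open>A\<close> and \<open>B\<close> later give
  \<open>A - B\<close> and \<open>B - A\<close> the same size \<open>j\<close>.\<close>

lemma ulam_dist_le_obtain:
  assumes "\<alpha> \<in> sym_perms n" "\<gamma> \<in> sym_perms n" "ulam_dist n \<alpha> \<gamma> \<le> k" "k \<le> n"
  obtains A where "A \<subseteq> {1..n}" "card A = k" "delete_symbols n \<alpha> A = delete_symbols n \<gamma> A"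
proof -
  obtain A0 where A0: "A0 \<subseteq> {1..n}" "card A0 = ulam_dist n \<alpha> \<gamma>"
      "delete_symbols n \<alpha> A0 = delete_symbols n \<gamma> A0"
    using ulam_dist_attained assms(1,2) by blast
  then obtain A where "A0 \<subseteq> A" "A \<subseteq> {1..n}" "card A = k"
    using exists_subset_between[of A0 k "{1..n}"] assms(3,4) by auto
  then show ?thesis using that delete_symbols_mono A0(3) by blast
qed

text \<open>Complements of deletion sets are chains. The distance being exactly \<open>k\<close>
  says that the longest chain has size \<open>n - k\<close>: a longer one would give a smaller
  deletion set. So \<open>card_chains_le\<close> applies with \<open>L = n - k\<close>.\<close>

lemma card_deletion_sets_le:
  assumes \<alpha>: "\<alpha> \<in> sym_perms n" and \<beta>: "\<beta> \<in> sym_perms n" and k: "ulam_dist n \<alpha> \<beta> = k"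
  shows "card {E. E \<subseteq> {1..n} \<and> card E = k + j \<and> delete_symbols n \<alpha> E = delete_symbols n \<beta> E}
    \<le> 2 ^ k * ((n - k) choose j)" (is "card ?E \<le> _")
proof (cases "k + j \<le> n")
  \<comment> \<open>Here \<open>n - (k + j)\<close> would truncate to 0, but no set \<open>E\<close>
    of this size exists.\<close>
  case False
  have "card E \<le> n" if "E \<subseteq> {1..n}" for E
    using card_mono[OF _ that] by simp
  then have "\<not> (E \<subseteq> {1..n} \<and> card E = k + j)" for E using False by metis
  then have "?E = {}" by blast
  then show ?thesis by (simp only: card.empty)
next
  case True
  let ?R = "precedes_in_both \<alpha> \<beta>"
  let ?X = "{X. X \<subseteq> {1..n} \<and> totalp_on X ?R \<and> card X = n - (k + j)}"
  have compl: "{1..n} - ({1..n} - X) = X" if "X \<subseteq> {1..n}" for X :: "nat set" using that by blast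
  have card_compl: "card ({1..n} - X) = n - card X" if "X \<subseteq> {1..n}" for X
    using that by (subst card_Diff_subset) (auto intro: finite_subset)
  have le_n: "card X \<le> n" if "X \<subseteq> {1..n}" for X using card_mono[OF _ that] by simp
  obtain A where A: "A \<subseteq> {1..n}" "card A = k" "delete_symbols n \<alpha> A = delete_symbols n \<beta> A"
    using ulam_dist_attained[OF \<alpha> \<beta>] k by blast
  have "inj_on (\<lambda>E. {1..n} - E) ?E"
  proof (rule inj_onI)
    fix E F assume "E \<in> ?E" "F \<in> ?E" "{1..n} - E = {1..n} - F"
    then have "{1..n} - ({1..n} - E) = {1..n} - ({1..n} - F)" by simp
    then show "E = F" using \<open>E \<in> ?E\<close> \<open>F \<in> ?E\<close> by (simp only: compl mem_Collect_eq)
  qed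
  moreover have "(\<lambda>E. {1..n} - E) ` ?E \<subseteq> ?X"
    using delete_symbols_eq_iff[OF \<alpha> \<beta>] card_compl by auto
  moreover have "finite ?X" by (rule finite_subset[of _ "Pow {1..n}"]) auto
  ultimately have "card ?E \<le> card ?X" by (rule card_inj_on_le)
  also have "\<dots> \<le> 2 ^ (card {1..n} - (n - k)) * ((n - k) choose (n - (k + j)))"
  proof (rule card_chains_le)
    show "transp ?R" by (auto simp: precedes_in_both_def intro: transpI)
    show "irreflp ?R" by (auto simp: precedes_in_both_def intro: irreflpI)
    show "totalp_on ({1..n} - A) ?R" using A(3) delete_symbols_eq_iff[OF \<alpha> \<beta>] by simp
    show "card ({1..n} - A) = n - k" using card_compl A by simp
    fix X assume X: "X \<subseteq> {1..n}" "totalp_on X ?R"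
    then have "delete_symbols n \<alpha> ({1..n} - X) = delete_symbols n \<beta> ({1..n} - X)"
      by (simp only: delete_symbols_eq_iff[OF \<alpha> \<beta>] compl)
    then have "k \<le> n - card X"
      using ulam_dist_le_card[of "{1..n} - X"] k card_compl[OF X(1)] by auto
    then show "card X \<le> n - k" using le_n[OF X(1)] True by linarith
  qed auto
  also have "card {1..n} - (n - k) = k" using True by simp
  also have "(n - k) choose (n - (k + j)) = (n - k) choose j"
    using True binomial_symmetric[of j "n - k"] by (simp add: diff_diff_left)
  finally show ?thesis .
qed

subsection \<open>Counting\<close>

text \<open>With nonnegative terms, the cube of a term is at most that term times the square of the
  whole sum; summing gives the cube of a partial sum of the exponential series.\<close>

lemma sum_power_cube_over_fact_cube_le:
  fixes x :: real
  assumes "0 \<le> x"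
  shows "(\<Sum>j\<le>k. x ^ (3 * j) / fact j ^ 3) \<le> exp (3 * x)"
proof -
  define f where "f j = x ^ j / fact j" for j :: nat
  have f: "0 \<le> f j" for j using assms by (simp add: f_def)
  have part: "(\<Sum>j\<le>k. f j) \<le> exp x"
  proof -
    have "f sums exp x" using exp_converges[of x] by (simp add: f_def[abs_def] field_simps)
    then show ?thesis using f sum_le_suminf[of f "{..k}"] by (auto simp: sums_iff)
  qed
  have "(\<Sum>j\<le>k. x ^ (3 * j) / fact j ^ 3) = (\<Sum>j\<le>k. f j ^ 3)"
    by (simp add: f_def power_divide mult.commute flip: power_mult)
  also have "\<dots> \<le> (\<Sum>j\<le>k. f j * (\<Sum>i\<le>k. f i) ^ 2)"
  proof (rule sum_mono)
    fix j assume "j \<in> {..k}"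
    then have "f j \<le> (\<Sum>i\<le>k. f i)" using f by (intro member_le_sum) auto
    then have "f j ^ 2 \<le> (\<Sum>i\<le>k. f i) ^ 2" using f by (intro power_mono)
    then have "f j * f j ^ 2 \<le> f j * (\<Sum>i\<le>k. f i) ^ 2" using f by (intro mult_left_mono)
    then show "f j ^ 3 \<le> f j * (\<Sum>i\<le>k. f i) ^ 2" by (simp add: power3_eq_cube power2_eq_square mult_ac)
  qed
  also have "\<dots> = (\<Sum>i\<le>k. f i) ^ 3"
    by (simp add: power3_eq_cube power2_eq_square flip: sum_distrib_right)
  also have "\<dots> \<le> exp x ^ 3" using f part by (intro power_mono sum_nonneg) auto
  also have "\<dots> = exp (3 * x)" by (simp flip: exp_of_nat_mult)
  finally show ?thesis .
qed

lemma card_UN_le_mult: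
  assumes "finite A" "\<And>a. a \<in> A \<Longrightarrow> real (card (F a)) \<le> c"
  shows "real (card (\<Union>a\<in>A. F a)) \<le> real (card A) * c"
proof -
  have "real (card (\<Union>a\<in>A. F a)) \<le> (\<Sum>a\<in>A. real (card (F a)))"
    using card_UN_le[OF assms(1), of F] by (simp flip: of_nat_sum)
  also have "\<dots> \<le> (\<Sum>a\<in>A. c)" using assms(2) by (rule sum_mono)
  finally show ?thesis by simp
qed

lemma card_ulam_ball_inter_le:
  assumes \<alpha>: "\<alpha> \<in> sym_perms n" and \<beta>: "\<beta> \<in> sym_perms n" and k: "ulam_dist n \<alpha> \<beta> = k"
  shows "real (card {\<gamma> \<in> sym_perms n. ulam_dist n \<alpha> \<gamma> \<le> k \<and> ulam_dist n \<beta> \<gamma> \<le> k})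
    \<le> 2 ^ k * (fact n / fact (n - k)) * (\<Sum>j\<le>k. 16 ^ j * real k ^ (2 * j) / fact j ^ 3)"
    (is "real (card ?G) \<le> _")
proof -
  have kn: "k \<le> n" using ulam_dist_le[OF \<alpha> \<beta>] k by simp
  define Es where "Es j =
    {E. E \<subseteq> {1..n} \<and> card E = k + j \<and> delete_symbols n \<alpha> E = delete_symbols n \<beta> E}" for j
  define Ss where "Ss E j = {P. P \<subseteq> E \<and> card P = j}" for E :: "nat set" and j
  \<comment> \<open>The strings of those \<open>\<gamma>\<close> that agree with
    \<open>\<alpha>\<close> off \<open>A = E - Q\<close> and with \<open>\<beta>\<close> off
    \<open>B = E - P\<close>.\<close>
  define \<Gamma> where "\<Gamma> E P Q = {xs. distinct xs \<and> set xs = {1..n} \<and>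
      filter (\<lambda>y. y \<notin> E - Q) xs = delete_symbols n \<alpha> (E - Q) \<and>
      filter (\<lambda>y. y \<notin> E - P) xs = delete_symbols n \<beta> (E - P)}" for E P Q
  define U where "U E j = (\<Union>P\<in>Ss E j. \<Union>Q\<in>{Q\<in>Ss E j. P \<inter> Q = {}}. \<Gamma> E P Q)" for E j
  have fin_Es: "finite (Es j)" for j
    by (rule finite_subset[of _ "Pow {1..n}"]) (auto simp: Es_def)
  have Ss: "finite (Ss E j)" "card (Ss E j) = (k + j) choose j" if "E \<in> Es j" for E j
  proof -
    have "finite E" "card E = k + j" using that by (auto simp: Es_def intro: finite_subset)
    then show "finite (Ss E j)" "card (Ss E j) = (k + j) choose j"
      using n_subsets[of E j] by (auto simp: Ss_def)
  qed
  have fin_\<Gamma>: "finite (\<Gamma> E P Q)" for E P Q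
    by (rule finite_subset[OF _ finite_subset_distinct[of "{1..n}"]]) (auto simp: \<Gamma>_def)
  have "one_line n ` ?G \<subseteq> (\<Union>j\<in>{..k}. \<Union>E\<in>Es j. U E j)"
  proof
    fix xs assume "xs \<in> one_line n ` ?G"
    then obtain \<gamma> where \<gamma>: "\<gamma> \<in> sym_perms n" "ulam_dist n \<alpha> \<gamma> \<le> k" "ulam_dist n \<beta> \<gamma> \<le> k"
      and xs: "xs = one_line n \<gamma>" by auto
    obtain A where A: "A \<subseteq> {1..n}" "card A = k" "delete_symbols n \<alpha> A = delete_symbols n \<gamma> A"
      using ulam_dist_le_obtain[OF \<alpha> \<gamma>(1,2) kn] .
    obtain B where B: "B \<subseteq> {1..n}" "card B = k" "delete_symbols n \<beta> B = delete_symbols n \<gamma> B"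
      using ulam_dist_le_obtain[OF \<beta> \<gamma>(1,3) kn] .
    have fin: "finite A" "finite B" using A B by (auto intro: finite_subset)
    define j where "j = card (B - A)"
    define E where "E = A \<union> B"
    have "card E = card A + card (B - A)"
      unfolding E_def using fin by (subst card_Un_disjoint[symmetric]) (auto intro: arg_cong)
    then have card_E: "card E = k + j" using A by (simp add: j_def)
    have "delete_symbols n \<alpha> E = delete_symbols n \<gamma> E"
      using delete_symbols_mono[OF A(3)] by (simp add: E_def)
    moreover have "delete_symbols n \<beta> E = delete_symbols n \<gamma> E"
      using delete_symbols_mono[OF B(3)] by (simp add: E_def)
    ultimately have E: "E \<in> Es j" using A(1) B(1) card_E by (simp add: Es_def E_def)
    have "j \<le> k" using card_mono[of B "B - A"] fin B by (auto simp: j_def)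
    \<comment> \<open>Both differences have size \<open>(k + j) - k = j\<close> because
      \<open>A\<close> and \<open>B\<close> have size \<open>k\<close>.\<close>
    moreover have "E - B \<in> Ss E j" "E - A \<in> Ss E j" "(E - B) \<inter> (E - A) = {}"
      using card_E fin A(2) B(2) by (auto simp: Ss_def E_def card_Diff_subset)
    moreover have "xs \<in> \<Gamma> E (E - B) (E - A)"
    proof -
      have "E - (E - A) = A" "E - (E - B) = B" by (auto simp: E_def)
      then show ?thesis
        using A(3) B(3) set_one_line[OF \<gamma>(1)] distinct_one_line[OF \<gamma>(1)]
        by (simp add: \<Gamma>_def xs delete_symbols_def)
    qed
    ultimately show "xs \<in> (\<Union>j\<in>{..k}. \<Union>E\<in>Es j. U E j)"
      unfolding U_def using E by blast
  qed
  moreover have "finite (\<Union>j\<in>{..k}. \<Union>E\<in>Es j. U E j)"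
    unfolding U_def using fin_Es Ss fin_\<Gamma> by auto
  ultimately have "card (one_line n ` ?G) \<le> card (\<Union>j\<in>{..k}. \<Union>E\<in>Es j. U E j)"
    by (rule card_mono[rotated])
  moreover have "card (one_line n ` ?G) = card ?G"
    by (intro card_image inj_on_subset[OF inj_on_one_line]) auto
  moreover have "card (\<Union>j\<in>{..k}. \<Union>E\<in>Es j. U E j) \<le> (\<Sum>j\<in>{..k}. card (\<Union>E\<in>Es j. U E j))"
    by (intro card_UN_le) simp
  ultimately have "card ?G \<le> (\<Sum>j\<in>{..k}. card (\<Union>E\<in>Es j. U E j))"
    by linarith
  then have "real (card ?G) \<le> (\<Sum>j\<in>{..k}. real (card (\<Union>E\<in>Es j. U E j)))"
    by (simp flip: of_nat_sum)
  also have "\<dots> \<le> (\<Sum>j\<in>{..k}. 2 ^ k * (fact n / fact (n - k)) *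
      (16 ^ j * real k ^ (2 * j) / fact j ^ 3))"
  proof (rule sum_mono)
    fix j assume "j \<in> {..k}"
    then have j: "j \<le> k" by simp
    \<comment> \<open>The factor \<open>4 ^ j\<close> is \<open>2 ^ (j + j)\<close> from the
      shuffles. The reinserted set has size \<open>(k + j) - 2 * j = k - j\<close>, which leaves
      \<open>n - k + j\<close> other symbols.\<close>
    define c where "c = 4 ^ j * (fact n / fact (n - k + j) :: real)"
    define b where "b = real ((k + j) choose j)"
    have \<Gamma>_le: "real (card (\<Gamma> E P Q)) \<le> c"
      if E: "E \<in> Es j" and P: "P \<in> Ss E j" and Q: "Q \<in> Ss E j" and disj: "P \<inter> Q = {}" for E P Q
    proof -
      have fin: "finite E" "finite P" "finite Q"
        using E P Q by (auto simp: Es_def Ss_def intro: finite_subset finite_subset[OF subset_trans])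
      have "E - P - Q = E - (P \<union> Q)" by blast
      moreover have "card (P \<union> Q) = 2 * j"
        using P Q disj fin by (simp add: card_Un_disjoint Ss_def)
      ultimately have "card (E - P - Q) = k - j"
        using E P Q fin j by (simp add: card_Diff_subset Es_def Ss_def)
      then have "n - card (E - P - Q) = n - k + j" using j kn by simp
      moreover have "card (\<Gamma> E P Q) * fact (card {1..n} - card (E - P - Q))
          \<le> 2 ^ (card P + card Q) * fact (card {1..n})"
        unfolding \<Gamma>_def using E P Q disj
        by (intro card_two_restrictions_le) (auto simp: Es_def Ss_def)
      ultimately have "card (\<Gamma> E P Q) * fact (n - k + j) \<le> 2 ^ (j + j) * fact n"
        using P Q by (simp add: Ss_def)
      then have "real (card (\<Gamma> E P Q) * fact (n - k + j)) \<le> real (2 ^ (j + j) * fact n)"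
        by (simp only: of_nat_le_iff)
      then have "real (card (\<Gamma> E P Q)) * fact (n - k + j) \<le> 4 ^ j * fact n"
        by (simp add: power_add flip: power_mult_distrib)
      then show ?thesis by (simp add: c_def field_simps)
    qed
    have c0: "0 \<le> c" by (simp add: c_def)
    have "real (card (U E j)) \<le> b * (b * c)" if E: "E \<in> Es j" for E
      unfolding U_def b_def Ss(2)[OF E, symmetric]
    proof (rule card_UN_le_mult[OF Ss(1)[OF E]])
      fix P assume P: "P \<in> Ss E j"
      have "real (card (\<Union>Q\<in>{Q\<in>Ss E j. P \<inter> Q = {}}. \<Gamma> E P Q))
          \<le> real (card {Q\<in>Ss E j. P \<inter> Q = {}}) * c"
        using Ss(1)[OF E] \<Gamma>_le[OF E P] by (intro card_UN_le_mult) auto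
      also have "\<dots> \<le> real (card (Ss E j)) * c"
        using Ss(1)[OF E] c0 by (intro mult_right_mono of_nat_mono card_mono) auto
      finally show "real (card (\<Union>Q\<in>{Q\<in>Ss E j. P \<inter> Q = {}}. \<Gamma> E P Q)) \<le> \<dots>" .
    qed
    then have "real (card (\<Union>E\<in>Es j. U E j)) \<le> real (card (Es j)) * (b * (b * c))"
      by (intro card_UN_le_mult fin_Es)
    also have "\<dots> \<le> real (2 ^ k * ((n - k) choose j)) * (b * (b * c))"
      unfolding Es_def using card_deletion_sets_le[OF \<alpha> \<beta> k, of j] c0
      by (intro mult_right_mono of_nat_mono) (auto simp: b_def)
    also have "\<dots> = 2 ^ k * 4 ^ j * b ^ 2 * (real ((n - k) choose j) * (fact n / fact (n - k + j)))"
      by (simp add: c_def power2_eq_square)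
    \<comment> \<open>Two of the three factors \<open>1 / fact j\<close> come from choosing
      \<open>P\<close> and \<open>Q\<close>, with \<open>k + j \<le> 2 * k\<close>. The third comes
      from \<open>(n - k) choose j \<le> (n - k + j) choose j\<close>, whose right side cancels
      \<open>fact (n - k + j)\<close>.\<close>
    also have "\<dots> \<le> 2 ^ k * 4 ^ j * ((2 * real k) ^ j / fact j) ^ 2 *
        (fact n / fact (n - k) / fact j)"
    proof (intro mult_mono power_mono)
      have "((k + j) choose j) * fact j \<le> (k + j) ^ j" by (rule binomial_fact_pow)
      also have "\<dots> \<le> (2 * k) ^ j" using j by (intro power_mono) auto
      finally have "real (((k + j) choose j) * fact j) \<le> real ((2 * k) ^ j)"
        by (simp only: of_nat_le_iff)
      then show "b \<le> (2 * real k) ^ j / fact j" by (simp add: b_def field_simps)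
      have "((n - k) choose j) * (fact j * fact (n - k))
          \<le> ((n - k + j) choose j) * (fact j * fact (n - k))"
        by (intro mult_right_mono binomial_right_mono) auto
      also have "\<dots> = fact (n - k + j)"
        using binomial_fact_lemma[of j "n - k + j"] by (simp add: algebra_simps)
      finally have "real (((n - k) choose j) * (fact j * fact (n - k))) \<le> real (fact (n - k + j))"
        by (simp only: of_nat_le_iff)
      then show "real ((n - k) choose j) * (fact n / fact (n - k + j))
          \<le> fact n / fact (n - k) / fact j"
        by (simp add: field_simps)
    qed (auto simp: b_def)
    also have "\<dots> = 2 ^ k * (fact n / fact (n - k)) * (16 ^ j * real k ^ (2 * j) / fact j ^ 3)"
    proof -
      have "((2 * real k) ^ j) ^ 2 = ((2 * real k) ^ 2) ^ j"
        by (simp only: power_mult[symmetric] mult.commute)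
      also have "\<dots> = 4 ^ j * real k ^ (2 * j)" by (simp add: power_mult_distrib power_mult)
      finally have "((2 * real k) ^ j) ^ 2 = 4 ^ j * real k ^ (2 * j)" .
      moreover have "(16::real) ^ j = 4 ^ j * 4 ^ j" by (simp flip: power_mult_distrib)
      ultimately show ?thesis
        by (simp only: power_divide) (simp add: power3_eq_cube power2_eq_square mult_ac)
    qed
    finally show "real (card (\<Union>E\<in>Es j. U E j))
      \<le> 2 ^ k * (fact n / fact (n - k)) * (16 ^ j * real k ^ (2 * j) / fact j ^ 3)" .
  qed
  finally show ?thesis by (simp only: sum_distrib_left)
qed

theorem theorem4:
  shows "\<exists>C::real. C \<ge> 0 \<and>
    (\<forall>(n::nat) (k::nat) (\<alpha>::nat \<Rightarrow> nat) (\<beta>::nat \<Rightarrow> nat).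
       n \<ge> 1 \<longrightarrow> \<alpha> \<in> sym_perms n \<longrightarrow> \<beta> \<in> sym_perms n \<longrightarrow> ulam_dist n \<alpha> \<beta> = k \<longrightarrow>
       real (card {\<gamma> \<in> sym_perms n. ulam_dist n \<alpha> \<gamma> \<le> k \<and> ulam_dist n \<beta> \<gamma> \<le> k})
         \<le> 2 powr (real k + C * real k powr (2/3)) * (fact n / fact (n - k)))"
proof (intro exI[of _ "9 / ln 2"] conjI allI impI)
  show "(0::real) \<le> 9 / ln 2" by simp
  fix n k :: nat and \<alpha> \<beta> :: "nat \<Rightarrow> nat"
  assume "\<alpha> \<in> sym_perms n" "\<beta> \<in> sym_perms n" "ulam_dist n \<alpha> \<beta> = k"
  then have "real (card {\<gamma> \<in> sym_perms n. ulam_dist n \<alpha> \<gamma> \<le> k \<and> ulam_dist n \<beta> \<gamma> \<le> k})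
    \<le> 2 ^ k * (fact n / fact (n - k)) * (\<Sum>j\<le>k. 16 ^ j * real k ^ (2 * j) / fact j ^ 3)"
    by (rule card_ulam_ball_inter_le)
  also have "\<dots> \<le> 2 ^ k * (fact n / fact (n - k)) * exp (9 * real k powr (2/3))"
  proof (intro mult_left_mono)
    \<comment> \<open>Rounding 16 up to the cube 27 makes \<open>x ^ 3 = 27 * k ^ 2\<close> with
      this \<open>x\<close>. Then \<open>exp (3 * x)\<close> has exponent
      \<open>9 * k powr (2/3)\<close>, and passing to base 2 yields the constant
      \<open>9 / ln 2\<close>.\<close>
    define x where "x = 3 * real k powr (2/3)"
    have "x ^ 3 = 27 * real k ^ 2"
    proof (cases "k = 0")
      case False
      then have "(real k powr (2/3)) ^ 3 = real k powr 2"
        by (simp add: powr_powr flip: powr_numeral)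
      then show ?thesis using False by (simp add: x_def power_mult_distrib)
    qed (simp add: x_def)
    then have cube: "x ^ (3 * j) = 27 ^ j * real k ^ (2 * j)" for j
      by (simp add: power_mult power_mult_distrib)
    have "(\<Sum>j\<le>k. 16 ^ j * real k ^ (2 * j) / fact j ^ 3) \<le> (\<Sum>j\<le>k. x ^ (3 * j) / fact j ^ 3)"
      unfolding cube by (intro sum_mono divide_right_mono mult_right_mono power_mono) auto
    also have "\<dots> \<le> exp (3 * x)"
      by (rule sum_power_cube_over_fact_cube_le) (simp add: x_def)
    finally show "(\<Sum>j\<le>k. 16 ^ j * real k ^ (2 * j) / fact j ^ 3) \<le> exp (9 * real k powr (2/3))"
      by (simp add: x_def)
  qed simp
  also have "\<dots> = 2 powr (real k + 9 / ln 2 * real k powr (2/3)) * (fact n / fact (n - k))"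
  proof -
    have "exp (9 * real k powr (2/3)) = 2 powr (9 / ln 2 * real k powr (2/3))"
      unfolding powr_def[of 2] by simp
    then show ?thesis by (simp add: powr_add powr_realpow)
  qed
  finally show "real (card {\<gamma> \<in> sym_perms n. ulam_dist n \<alpha> \<gamma> \<le> k \<and> ulam_dist n \<beta> \<gamma> \<le> k})
    \<le> 2 powr (real k + 9 / ln 2 * real k powr (2/3)) * (fact n / fact (n - k))" .
qed

end
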